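(* Let $\sigma$ be a left-cancellable connection on $B(\mathcal{H})^+$ with representing function $f:[0,\infty)\to[0,\infty)$. Then the following statements are equivalent (with unknowns $x\in[0,\infty)$ and $X\in B(\mathcal{H})^+$): (1) $\sigma$ is nonregular; (2) the equation $f(x)=0$ has a solution $x$; (3) the equation $f(x)=0$ has a unique solution $x$; (4) the only solution to $f(x)=0$ is $x=0$; (5) for each $A>0$, the equation $A\,\sigma\,X=0$ has a solution $X$; (6) for each $A>0$, the equation $A\,\sigma\,X=0$ has a unique solution $X$; (7) for each $A>0$, the only solution to the equation $A\,\sigma\,X=0$ is $X=0$; (8) the equation $I\,\sigma\,X=0$ has a solution $X$; (9) the equation $I\,\sigma\,X=0$ has a unique solution $X$; (10) the only solution to the equation $I\,\sigma\,X=0$ is $X=0$. Similarly, if $\sigma$ is a right-cancellable connection, then the ten analogous statements are equivalent, obtained from (1)–(10) by replacing $\sigma$ by its transpose and $f$ by the representing function $g$ of the transpose (so that "$\sigma$ is nonregular" becomes "the transpose of $\sigma$ is nonregular", and the equations $f(x)=0$, $A\,\sigma\,X=0$, $I\,\sigma\,X=0$ become $g(x)=0$, $X\,\sigma\,A=0$, $X\,\sigma\,I=0$). In (4), (7), (10), "the only solution is $0$" means that $0$ is a solution and there is no other.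
   Context: $\mathcal{H}$ is a Hilbert space, $B(\mathcal{H})$ the bounded linear operators on it, $B(\mathcal{H})^+$ the positive (semidefinite) operators; $A\le B$ means $B-A\in B(\mathcal{H})^+$; $A>0$ means $A$ is strictly positive (positive and invertible). A connection is a binary operation $\sigma$ on $B(\mathcal{H})^+$ such that for all positive $A,B,C,D$: (M1) $A\le C$, $B\le D$ imply $A\,\sigma\,B\le C\,\sigma\,D$; (M2) $C(A\,\sigma\,B)C\le (CAC)\,\sigma\,(CBC)$; (M3) if $A_n\downarrow A$ and $B_n\downarrow B$ then $A_n\,\sigma\,B_n\downarrow A\,\sigma\,B$, where $A_n\downarrow A$ means $(A_n)$ is a decreasing sequence converging strongly to $A$. The transpose of $\sigma$ is the connection $(A,B)\mapsto B\,\sigma\,A$. A connection $\sigma$ is left cancellable if for all $A>0$, $B\ge0$, $C\ge0$, $A\,\sigma\,B=A\,\sigma\,C$ implies $B=C$; right cancellable if for all $A>0$, $B\ge0$, $C\ge0$, $B\,\sigma\,A=C\,\sigma\,A$ implies $B=C$. A function $f:[0,\infty)\to[0,\infty)$ is operator monotone if (with the continuous functional calculus, $f$ continuous) $A\le B$ implies $f(A)\le f(B)$ for all positive operators $A,B$ on every Hilbert space. Representing function (Kubo–Ando theorem, taken as known): for a connection $\sigma$ there is a unique operator monotone $f:[0,\infty)\to[0,\infty)$ with $f(x)I=I\,\sigma\,(xI)$ for all $x\ge 0$; $\sigma\mapsto f$ is a bijection, and $f(A)=I\,\sigma\,A$ for all $A\ge0$. A connection is nonregular if its representing function $f$ satisfies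 $f(0)=0$ (equivalently $I\,\sigma\,0=0$). *)

theory Defs
  imports "HOL-Analysis.Analysis" "HOL-Computational_Algebra.Polynomial"
begin

(* The inner product is linear in the first argument.  Definiteness follows from norm_eq_sqrt_cinner
   and the norm axioms, and 1 acting as the identity follows from scaleC_of_real. *)
class complex_hilbert = banach +
  fixes scaleC :: "complex \<Rightarrow> 'a \<Rightarrow> 'a" (infixr \<open>*\<^sub>C\<close> 75)
    and cinner :: "'a \<Rightarrow> 'a \<Rightarrow> complex"
  assumes scaleC_add_right: "a *\<^sub>C (x + y) = a *\<^sub>C x + a *\<^sub>C y"
    and scaleC_add_left: "(a + b) *\<^sub>C x = a *\<^sub>C x + b *\<^sub>C x"
    and scaleC_scaleC: "a *\<^sub>C (b *\<^sub>C x) = (a * b) *\<^sub>C x"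
    and scaleC_of_real: "complex_of_real r *\<^sub>C x = r *\<^sub>R x"
    and cinner_commute: "cinner x y = cnj (cinner y x)"
    and cinner_add_left: "cinner (x + y) z = cinner x z + cinner y z"
    and cinner_scaleC_left: "cinner (a *\<^sub>C x) y = a * cinner x y"
    and cinner_self_nonneg: "0 \<le> Re (cinner x x)"
    and norm_eq_sqrt_cinner: "norm x = sqrt (Re (cinner x x))"

(* Library bounded operators are only real-linear; B(H) consists of the complex-linear ones. *)
definition bounded_ops :: "('h::complex_hilbert \<Rightarrow>\<^sub>L 'h) set" where
  "bounded_ops = {A. \<forall>c x. blinfun_apply A (c *\<^sub>C x) = c *\<^sub>C blinfun_apply A x}"

definition positive_ops :: "('h::complex_hilbert \<Rightarrow>\<^sub>L 'h) set" where
  "positive_ops = {A \<in> bounded_ops.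
     \<forall>x. cinner (blinfun_apply A x) x \<in> \<real> \<and> 0 \<le> Re (cinner (blinfun_apply A x) x)}"

definition op_le :: "('h::complex_hilbert \<Rightarrow>\<^sub>L 'h) \<Rightarrow> ('h \<Rightarrow>\<^sub>L 'h) \<Rightarrow> bool" (infix \<open>\<preceq>\<close> 50) where
  "A \<preceq> B \<longleftrightarrow> B - A \<in> positive_ops"

definition strictly_positive_ops :: "('h::complex_hilbert \<Rightarrow>\<^sub>L 'h) set" where
  "strictly_positive_ops =
     {A \<in> positive_ops. \<exists>B\<in>bounded_ops. A o\<^sub>L B = id_blinfun \<and> B o\<^sub>L A = id_blinfun}"

definition decreases_to :: "(nat \<Rightarrow> ('h::complex_hilbert \<Rightarrow>\<^sub>L 'h)) \<Rightarrow> ('h \<Rightarrow>\<^sub>L 'h) \<Rightarrow> bool" where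
  "decreases_to S A \<longleftrightarrow>
     (\<forall>n. S (Suc n) \<preceq> S n) \<and>
     (\<forall>x. (\<lambda>n. blinfun_apply (S n) x) \<longlonglongrightarrow> blinfun_apply A x)"

type_synonym 'h op_binary = "('h \<Rightarrow>\<^sub>L 'h) \<Rightarrow> ('h \<Rightarrow>\<^sub>L 'h) \<Rightarrow> ('h \<Rightarrow>\<^sub>L 'h)"

(* A binary operation on the positive operators is a total function whose values outside the
   positive operators are irrelevant. *)
definition connection :: "'h::complex_hilbert op_binary \<Rightarrow> bool" where
  "connection \<sigma> \<longleftrightarrow>
     (\<forall>A\<in>positive_ops. \<forall>B\<in>positive_ops. \<sigma> A B \<in> positive_ops) \<and>
     (\<forall>A\<in>positive_ops. \<forall>B\<in>positive_ops. \<forall>C\<in>positive_ops. \<forall>D\<in>positive_ops.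
        A \<preceq> C \<longrightarrow> B \<preceq> D \<longrightarrow> \<sigma> A B \<preceq> \<sigma> C D) \<and>
     (\<forall>A\<in>positive_ops. \<forall>B\<in>positive_ops. \<forall>C\<in>positive_ops.
        C o\<^sub>L \<sigma> A B o\<^sub>L C \<preceq> \<sigma> (C o\<^sub>L A o\<^sub>L C) (C o\<^sub>L B o\<^sub>L C)) \<and>
     (\<forall>S T. \<forall>A\<in>positive_ops. \<forall>B\<in>positive_ops.
        (\<forall>n. S n \<in> positive_ops) \<longrightarrow> (\<forall>n. T n \<in> positive_ops) \<longrightarrow>
        decreases_to S A \<longrightarrow> decreases_to T B \<longrightarrow>
        decreases_to (\<lambda>n. \<sigma> (S n) (T n)) (\<sigma> A B))"

definition transposed :: "'h::complex_hilbert op_binary \<Rightarrow> 'h op_binary" where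
  "transposed \<sigma> = (\<lambda>A B. \<sigma> B A)"

definition left_cancellable :: "'h::complex_hilbert op_binary \<Rightarrow> bool" where
  "left_cancellable \<sigma> \<longleftrightarrow>
     (\<forall>A\<in>strictly_positive_ops. \<forall>B\<in>positive_ops. \<forall>C\<in>positive_ops. \<sigma> A B = \<sigma> A C \<longrightarrow> B = C)"

definition right_cancellable :: "'h::complex_hilbert op_binary \<Rightarrow> bool" where
  "right_cancellable \<sigma> \<longleftrightarrow>
     (\<forall>A\<in>strictly_positive_ops. \<forall>B\<in>positive_ops. \<forall>C\<in>positive_ops. \<sigma> B A = \<sigma> C A \<longrightarrow> B = C)"

definition poly_op :: "real poly \<Rightarrow> ('h::complex_hilbert \<Rightarrow>\<^sub>L 'h) \<Rightarrow> ('h \<Rightarrow>\<^sub>L 'h)" where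
  "poly_op p A = (\<Sum>i\<le>degree p. coeff p i *\<^sub>R (((o\<^sub>L) A ^^ i) id_blinfun))"

(* Continuous functional calculus f(A) of a positive operator A, whose spectrum lies in
   {0..norm A}: the norm limit of p_n(A) for any polynomials p_n tending to f uniformly there. *)
definition fun_calc :: "(real \<Rightarrow> real) \<Rightarrow> ('h::complex_hilbert \<Rightarrow>\<^sub>L 'h) \<Rightarrow> ('h \<Rightarrow>\<^sub>L 'h)" where
  "fun_calc f A = (THE B. \<exists>p. uniform_limit {0..norm A} (\<lambda>n. poly (p n)) f sequentially \<and>
                            (\<lambda>n. poly_op (p n) A) \<longlonglongrightarrow> B)"

(* A function on [0,\<infinity>) is given by a real function whose values at negative arguments are irrelevant. *)
definition operator_monotone :: "'h::complex_hilbert itself \<Rightarrow> (real \<Rightarrow> real) \<Rightarrow> bool" where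
  "operator_monotone _ f \<longleftrightarrow>
     (\<forall>x\<ge>0. 0 \<le> f x) \<and> continuous_on {0..} f \<and>
     (\<forall>A\<in>(positive_ops :: ('h \<Rightarrow>\<^sub>L 'h) set). \<forall>B\<in>positive_ops.
        A \<preceq> B \<longrightarrow> fun_calc f A \<preceq> fun_calc f B)"

(* HOL cannot quantify over all Hilbert spaces here, so operator monotonicity is required on the
   space H itself.  The last conjunct alone determines f on [0,\<infinity>) when H is nonzero, so for every
   connection with an operator monotone representing function in the sense of all Hilbert spaces,
   that function is the one described here. *)
definition representing_function :: "'h::complex_hilbert op_binary \<Rightarrow> (real \<Rightarrow> real) \<Rightarrow> bool" where
  "representing_function \<sigma> f \<longleftrightarrow>
     operator_monotone TYPE('h) f \<and>
     (\<forall>x\<ge>0. f x *\<^sub>R id_blinfun = \<sigma> id_blinfun (x *\<^sub>R id_blinfun))"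

definition nonregular :: "'h::complex_hilbert op_binary \<Rightarrow> bool" where
  "nonregular \<sigma> \<longleftrightarrow> (\<exists>f. representing_function \<sigma> f \<and> f 0 = 0)"

definition all_equivalent :: "bool list \<Rightarrow> bool" where
  "all_equivalent Ps \<longleftrightarrow> (\<forall>P\<in>set Ps. \<forall>Q\<in>set Ps. P \<longleftrightarrow> Q)"

end

theory Submission
  imports Defs
begin

(* Monotonicity turns any solution of A \<sigma> X = 0 into A \<sigma> 0 = 0, and then X = 0 by
   cancellability.  So every statement reduces to A \<sigma> 0 = 0 for a suitable A > 0.  The choice
   of A is immaterial: I \<sigma> 0 = 0 gives cI \<sigma> 0 = 0 by the transformer inequality with
   C = c^(-1/2) I, and hence A \<sigma> 0 = 0 since A \<le> cI for some c > 0. *)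

section \<open>Inner product identities and the quadratic form of an operator\<close>

lemma cinner_add_right: "cinner x (y + z) = cinner x y + cinner x z"
  by (metis cinner_add_left cinner_commute complex_cnj_add)

lemma cinner_scaleC_right: "cinner x (a *\<^sub>C y) = cnj a * cinner x y"
  by (metis cinner_commute cinner_scaleC_left complex_cnj_mult)

lemma cinner_scaleR_left: "cinner (r *\<^sub>R x) y = of_real r * cinner x y"
  by (metis cinner_scaleC_left scaleC_of_real)

lemma cinner_zero_left [simp]: "cinner 0 y = 0"
  using cinner_scaleR_left[of 0 0 y] by simp

lemma cinner_diff_left: "cinner (x - y) z = cinner x z - cinner y z"
  by (metis add_diff_cancel_right' cinner_add_left diff_add_cancel)

lemma cinner_self_real: "cinner x x = of_real ((norm x)\<^sup>2)"
proof -
  have "cinner x x = of_real (Re (cinner x x))"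
    using cinner_commute[of x x] by (simp add: complex_eq_iff)
  then show ?thesis
    by (simp add: norm_eq_sqrt_cinner cinner_self_nonneg)
qed

text \<open>The real part of Cauchy-Schwarz. Since \<open>norm\<close> already satisfies the
  triangle inequality as part of the type class, it suffices to square that inequality and compare
  cross terms.\<close>

lemma Re_cinner_le: "Re (cinner x y) \<le> norm x * norm y"
proof -
  have "(norm (x + y))\<^sup>2 = Re (cinner (x + y) (x + y))"
    by (simp add: cinner_self_real)
  also have "\<dots> = (norm x)\<^sup>2 + (norm y)\<^sup>2 + 2 * Re (cinner x y)"
    using cinner_commute[of y x]
    by (simp add: cinner_add_left cinner_add_right cinner_self_real[of x] cinner_self_real[of y])
  finally have "(norm x)\<^sup>2 + (norm y)\<^sup>2 + 2 * Re (cinner x y) = (norm (x + y))\<^sup>2" by simp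
  also have "\<dots> \<le> (norm x + norm y)\<^sup>2"
    by (intro power_mono norm_triangle_ineq norm_ge_zero)
  finally show ?thesis by (simp add: power2_sum)
qed

text \<open>Polarization over the complex scalars. Complex linearity is essential: a quarter turn of
  the real plane has vanishing quadratic form without being zero.\<close>

lemma blinfun_eq_0_if_quadratic_form_0:
  assumes lin: "A \<in> bounded_ops" and zero: "\<And>x. cinner (blinfun_apply A x) x = 0"
  shows "A = 0"
proof (rule blinfun_eqI)
  fix x
  have cross: "cinner (A u) v + cinner (A v) u = 0" for u v
    using zero[of "u + v"] zero[of u] zero[of v]
    by (simp add: blinfun.add_right cinner_add_left cinner_add_right add.commute)
  \<comment> \<open>The vanishing cross terms are used at \<open>x\<close> and at
    \<open>\<i> *\<^sub>C x\<close>, both against \<open>A x\<close>. The second slot is conjugate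
    linear, so the factor \<open>\<i>\<close> turns the sum of the two terms into a difference. Sum
    and difference both vanish, hence so does each term.\<close>
  have "A (\<i> *\<^sub>C x) = \<i> *\<^sub>C A x"
    using lin by (simp add: bounded_ops_def)
  then have "\<i> * cinner (A x) (A x) - \<i> * cinner (A (A x)) x = 0"
    using cross[of "\<i> *\<^sub>C x" "A x"] by (simp add: cinner_scaleC_left cinner_scaleC_right)
  then have "\<i> * (cinner (A x) (A x) - cinner (A (A x)) x) = 0"
    by (simp add: right_diff_distrib)
  then have "cinner (A x) (A x) = cinner (A (A x)) x"
    by simp
  with cross[of x "A x"] have "cinner (A x) (A x) = 0"
    by simp
  then show "A x = blinfun_apply 0 x"
    by (simp add: cinner_self_real)
qed

section \<open>The cone of positive operators and its order\<close>

lemma scaleR_in_positive_ops: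
  assumes "A \<in> positive_ops" "0 \<le> r"
  shows "r *\<^sub>R A \<in> positive_ops"
proof -
  have "r *\<^sub>R (c *\<^sub>C x) = c *\<^sub>C (r *\<^sub>R x)" for c and x :: 'a
    by (simp add: scaleC_scaleC mult.commute flip: scaleC_of_real)
  with assms show ?thesis
    by (auto simp: positive_ops_def bounded_ops_def blinfun.scaleR_left cinner_scaleR_left
        intro!: Reals_mult)
qed

lemma id_in_positive_ops [simp]: "id_blinfun \<in> positive_ops"
  by (simp add: positive_ops_def bounded_ops_def cinner_self_real)

lemmas scaleR_id_in_positive_ops = scaleR_in_positive_ops[OF id_in_positive_ops]

lemma zero_in_positive_ops [simp]: "0 \<in> positive_ops"
  using scaleR_id_in_positive_ops[of 0] by simp

lemma id_in_strictly_positive_ops [simp]: "id_blinfun \<in> strictly_positive_ops"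
proof -
  have "id_blinfun \<in> (bounded_ops :: ('a \<Rightarrow>\<^sub>L 'a) set)"
    by (simp add: bounded_ops_def)
  then show ?thesis
    by (auto simp: strictly_positive_ops_def intro!: bexI[of _ id_blinfun] blinfun_eqI)
qed

text \<open>The quadratic form of \<open>A\<close> is real and both nonnegative and nonpositive, so
  it vanishes and polarization applies. This is the only instance of antisymmetry of the order that
  is used.\<close>

lemma op_le_zero_iff:
  assumes "A \<in> positive_ops"
  shows "A \<preceq> 0 \<longleftrightarrow> A = 0"
proof
  assume "A \<preceq> 0"
  then have "Re (cinner (- A x) x) \<ge> 0" for x
    by (simp add: op_le_def positive_ops_def blinfun.minus_left)
  then have "Re (cinner (A x) x) \<le> 0" for x
    using cinner_diff_left[of 0 "A x" x] by (smt (verit) cinner_zero_left diff_0 minus_complex.sel(1) zero_complex.sel(1))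
  moreover have "Re (cinner (A x) x) \<ge> 0" "cinner (A x) x \<in> \<real>" for x
    using assms by (auto simp: positive_ops_def)
  ultimately have "cinner (A x) x = 0" for x
    by (metis complex_eq_iff complex_is_Real_iff order_antisym zero_complex.sel)
  then show "A = 0"
    using assms by (intro blinfun_eq_0_if_quadratic_form_0) (auto simp: positive_ops_def)
qed (simp add: op_le_def)

lemma diff_in_bounded_ops:
  assumes "A \<in> bounded_ops" "B \<in> bounded_ops"
  shows "A - B \<in> bounded_ops"
proof -
  have "c *\<^sub>C x - c *\<^sub>C y = c *\<^sub>C (x - y)" for c and x y :: 'a
    by (metis add_diff_cancel_right' diff_add_cancel scaleC_add_right)
  with assms show ?thesis
    by (simp add: bounded_ops_def blinfun.diff_left)
qed

text \<open>Cauchy-Schwarz and the operator norm bound the quadratic form of \<open>A\<close> at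
  \<open>x\<close> by \<open>r\<close> times the squared norm of \<open>x\<close>.\<close>

lemma positive_op_le_scaleR_id:
  assumes A: "A \<in> positive_ops" and r: "norm A \<le> r"
  shows "A \<preceq> r *\<^sub>R id_blinfun"
proof -
  have r0: "0 \<le> r"
    using r norm_ge_zero order_trans by blast
  have "r *\<^sub>R id_blinfun - A \<in> bounded_ops"
    using A scaleR_id_in_positive_ops[OF r0]
    by (intro diff_in_bounded_ops) (auto simp: positive_ops_def)
  moreover have "cinner ((r *\<^sub>R id_blinfun - A) x) x \<in> \<real>"
    and "0 \<le> Re (cinner ((r *\<^sub>R id_blinfun - A) x) x)" for x
  proof -
    have eq: "cinner ((r *\<^sub>R id_blinfun - A) x) x = of_real (r * (norm x)\<^sup>2) - cinner (A x) x"
      by (simp add: blinfun.diff_left blinfun.scaleR_left cinner_diff_left cinner_scaleR_left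
          cinner_self_real)
    show "cinner ((r *\<^sub>R id_blinfun - A) x) x \<in> \<real>"
      unfolding eq using A by (intro Reals_diff Reals_of_real) (simp add: positive_ops_def)
    have "Re (cinner (A x) x) \<le> norm (A x) * norm x"
      by (rule Re_cinner_le)
    also have "\<dots> \<le> (r * norm x) * norm x"
      using norm_blinfun[of A x] mult_right_mono[OF r norm_ge_zero[of x]]
      by (intro mult_right_mono) auto
    finally show "0 \<le> Re (cinner ((r *\<^sub>R id_blinfun - A) x) x)"
      unfolding eq by (simp add: power2_eq_square mult.assoc)
  qed
  ultimately show ?thesis
    by (simp add: op_le_def positive_ops_def)
qed

lemma op_le_refl [simp]: "A \<preceq> A"
  by (simp add: op_le_def)

lemma zero_op_le_iff [simp]: "0 \<preceq> A \<longleftrightarrow> A \<in> positive_ops"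
  by (simp add: op_le_def)

section \<open>Connections and the zeros of their values\<close>

lemma connection_transposed: "connection \<sigma> \<Longrightarrow> connection (transposed \<sigma>)"
  unfolding connection_def transposed_def by blast

lemma connection_positive:
  "connection \<sigma> \<Longrightarrow> A \<in> positive_ops \<Longrightarrow> B \<in> positive_ops \<Longrightarrow> \<sigma> A B \<in> positive_ops"
  by (simp add: connection_def)

lemma connection_mono:
  assumes "connection \<sigma>" "A \<in> positive_ops" "B \<in> positive_ops" "C \<in> positive_ops"
    "D \<in> positive_ops" "A \<preceq> C" "B \<preceq> D"
  shows "\<sigma> A B \<preceq> \<sigma> C D"
  using assms by (simp add: connection_def)

lemma connection_transformer:
  assumes "connection \<sigma>" "A \<in> positive_ops" "B \<in> positive_ops" "C \<in> positive_ops"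
  shows "C o\<^sub>L \<sigma> A B o\<^sub>L C \<preceq> \<sigma> (C o\<^sub>L A o\<^sub>L C) (C o\<^sub>L B o\<^sub>L C)"
  using assms by (simp add: connection_def)

text \<open>By monotonicity \<open>\<sigma> A B\<close> lies below 0, and it is positive as a value
  of a connection.\<close>

lemma connection_eq_0_antimono:
  assumes "connection \<sigma>" "A \<in> positive_ops" "B \<in> positive_ops" "C \<in> positive_ops"
    "D \<in> positive_ops" "A \<preceq> C" "B \<preceq> D" "\<sigma> C D = 0"
  shows "\<sigma> A B = 0"
  using connection_mono[of \<sigma> A B C D] op_le_zero_iff connection_positive assms by metis

lemma connection_zero_right_eq_0:
  assumes conn: "connection \<sigma>" and A: "A \<in> positive_ops" and zero: "\<sigma> id_blinfun 0 = 0"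
  shows "\<sigma> A 0 = 0"
proof -
  \<comment> \<open>The summand 1 keeps \<open>c\<close> positive even for \<open>A = 0\<close>, so
    that \<open>1 / sqrt c\<close> is a genuine inverse square root.\<close>
  define c where "c = norm A + 1"
  have c: "c > 0" "norm A \<le> c"
    by (auto simp: c_def add_nonneg_pos)
  let ?C = "(1 / sqrt c) *\<^sub>R id_blinfun :: 'a \<Rightarrow>\<^sub>L 'a"
  let ?B = "c *\<^sub>R id_blinfun :: 'a \<Rightarrow>\<^sub>L 'a"
  have pos: "?C \<in> positive_ops" "?B \<in> positive_ops"
    using c by (auto intro!: scaleR_id_in_positive_ops)
  have "?C o\<^sub>L \<sigma> ?B 0 o\<^sub>L ?C \<preceq> \<sigma> (?C o\<^sub>L ?B o\<^sub>L ?C) (?C o\<^sub>L 0 o\<^sub>L ?C)"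
    by (rule connection_transformer[OF conn pos(2) zero_in_positive_ops pos(1)])
  \<comment> \<open>Conjugation by a scalar operator is scaling by the square of the scalar. It
    sends \<open>?B\<close> to the identity and fixes 0, so the right-hand side of the transformer
    inequality becomes \<open>\<sigma> id_blinfun 0\<close>.\<close>
  moreover have "?C o\<^sub>L T o\<^sub>L ?C = (1 / c) *\<^sub>R T" for T
    using c by (intro blinfun_eqI) (simp add: blinfun.scaleR_left blinfun.scaleR_right)
  ultimately have "(1 / c) *\<^sub>R \<sigma> ?B 0 \<preceq> 0"
    using c zero by simp
  moreover have "(1 / c) *\<^sub>R \<sigma> ?B 0 \<in> positive_ops"
    using connection_positive[OF conn pos(2) zero_in_positive_ops] c
    by (intro scaleR_in_positive_ops) auto
  ultimately have "(1 / c) *\<^sub>R \<sigma> ?B 0 = 0"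
    using op_le_zero_iff by blast
  then have "\<sigma> ?B 0 = 0"
    using c by simp
  then show ?thesis
    using connection_eq_0_antimono[OF conn A _ pos(2), of 0 0]
      positive_op_le_scaleR_id[OF A c(2)] by simp
qed

text \<open>Each of the ten statements is shown equivalent to
  \<open>\<sigma> id_blinfun 0 = 0\<close>. A nonzero vector makes the identity operator nonzero, so
  that scalars can be read off from multiples of it.\<close>

lemma left_cancellable_zero_equivalences:
  fixes \<sigma> :: "'h::complex_hilbert op_binary"
  assumes nontrivial: "\<exists>v::'h. v \<noteq> 0"
    and conn: "connection \<sigma>"
    and canc: "left_cancellable \<sigma>"
    and rep: "representing_function \<sigma> f"
  shows "all_equivalent
      [nonregular \<sigma>,
       \<exists>x\<ge>0. f x = 0,
       \<exists>!x. x \<ge> 0 \<and> f x = 0,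
       \<forall>x\<ge>0. f x = 0 \<longleftrightarrow> x = 0,
       \<forall>A\<in>strictly_positive_ops. \<exists>X\<in>positive_ops. \<sigma> A X = 0,
       \<forall>A\<in>strictly_positive_ops. \<exists>!X. X \<in> positive_ops \<and> \<sigma> A X = 0,
       \<forall>A\<in>strictly_positive_ops. \<forall>X\<in>positive_ops. \<sigma> A X = 0 \<longleftrightarrow> X = 0,
       \<exists>X\<in>positive_ops. \<sigma> id_blinfun X = 0,
       \<exists>!X. X \<in> positive_ops \<and> \<sigma> id_blinfun X = 0,
       \<forall>X\<in>positive_ops. \<sigma> id_blinfun X = 0 \<longleftrightarrow> X = 0]"
proof -
  have id0: "(id_blinfun :: 'h \<Rightarrow>\<^sub>L 'h) \<noteq> 0"
    using nontrivial by (metis blinfun_apply_id_blinfun id_apply zero_blinfun.rep_eq)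
  have f0: "f x = 0 \<longleftrightarrow> \<sigma> id_blinfun (x *\<^sub>R id_blinfun) = 0" if "x \<ge> 0" for x
    using rep that id0 unfolding representing_function_def by (metis scaleR_eq_0_iff)
  have f00: "f 0 = 0 \<longleftrightarrow> \<sigma> id_blinfun 0 = 0"
    using f0[of 0] by simp
  have pos: "A \<in> positive_ops" if "A \<in> strictly_positive_ops" for A :: "'h \<Rightarrow>\<^sub>L 'h"
    using that by (simp add: strictly_positive_ops_def)
  \<comment> \<open>The solution set in \<open>X\<close> is thus either empty or the singleton of 0,
    which is why existence, unique existence and having 0 as the only solution coincide.\<close>
  have sol: "\<sigma> A X = 0 \<longleftrightarrow> \<sigma> A 0 = 0 \<and> X = 0"
    if A: "A \<in> strictly_positive_ops" and X: "X \<in> positive_ops" for A X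
  proof
    assume eq: "\<sigma> A X = 0"
    then have "\<sigma> A 0 = 0"
      using connection_eq_0_antimono[OF conn pos[OF A] _ pos[OF A] X] X by simp
    with eq show "\<sigma> A 0 = 0 \<and> X = 0"
      using canc A X unfolding left_cancellable_def by (metis zero_in_positive_ops)
  qed auto
  \<comment> \<open>The same dichotomy for \<open>f\<close>, obtained from the operator equation
    with \<open>A\<close> the identity and \<open>X\<close> a scalar multiple of it.\<close>
  have fsol: "f x = 0 \<longleftrightarrow> f 0 = 0 \<and> x = 0" if "x \<ge> 0" for x
    using f0[OF that] f00 sol[OF _ scaleR_id_in_positive_ops[OF that]] id0 by simp
  have Asol: "\<sigma> A 0 = 0" if "A \<in> strictly_positive_ops" "\<sigma> id_blinfun 0 = 0" for A
    using connection_zero_right_eq_0[OF conn pos] that by blast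
  \<comment> \<open>\<open>nonregular\<close> asks for some representing function that vanishes at
    0. All representing functions of \<sigma> agree there, because their value at 0 times the
    identity is \<open>\<sigma> id_blinfun 0\<close>.\<close>
  have 1: "nonregular \<sigma> \<longleftrightarrow> \<sigma> id_blinfun 0 = 0"
    using rep f00 unfolding nonregular_def representing_function_def
    by (metis order_refl scaleR_zero_left)
  have 2: "(\<exists>x\<ge>0. f x = 0) \<longleftrightarrow> \<sigma> id_blinfun 0 = 0"
    using fsol f00 by blast
  have 3: "(\<exists>!x. x \<ge> 0 \<and> f x = 0) \<longleftrightarrow> \<sigma> id_blinfun 0 = 0"
    using fsol f00 by blast
  have 4: "(\<forall>x\<ge>0. f x = 0 \<longleftrightarrow> x = 0) \<longleftrightarrow> \<sigma> id_blinfun 0 = 0"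
    using fsol f00 by blast
  \<comment> \<open>For the statements about all strictly positive \<open>A\<close>, one direction
    specializes to the identity and the other is \<open>Asol\<close>.\<close>
  have 5: "(\<forall>A\<in>strictly_positive_ops. \<exists>X\<in>positive_ops. \<sigma> A X = 0) \<longleftrightarrow> \<sigma> id_blinfun 0 = 0"
    using sol Asol zero_in_positive_ops id_in_strictly_positive_ops by metis
  have 6: "(\<forall>A\<in>strictly_positive_ops. \<exists>!X. X \<in> positive_ops \<and> \<sigma> A X = 0) \<longleftrightarrow>
      \<sigma> id_blinfun 0 = 0"
    using sol Asol zero_in_positive_ops id_in_strictly_positive_ops by metis
  have 7: "(\<forall>A\<in>strictly_positive_ops. \<forall>X\<in>positive_ops. \<sigma> A X = 0 \<longleftrightarrow> X = 0) \<longleftrightarrow>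
      \<sigma> id_blinfun 0 = 0"
    using sol Asol zero_in_positive_ops id_in_strictly_positive_ops by metis
  have 8: "(\<exists>X\<in>positive_ops. \<sigma> id_blinfun X = 0) \<longleftrightarrow> \<sigma> id_blinfun 0 = 0"
    using sol zero_in_positive_ops id_in_strictly_positive_ops by metis
  have 9: "(\<exists>!X. X \<in> positive_ops \<and> \<sigma> id_blinfun X = 0) \<longleftrightarrow> \<sigma> id_blinfun 0 = 0"
    using sol zero_in_positive_ops id_in_strictly_positive_ops by metis
  have 10: "(\<forall>X\<in>positive_ops. \<sigma> id_blinfun X = 0 \<longleftrightarrow> X = 0) \<longleftrightarrow> \<sigma> id_blinfun 0 = 0"
    using sol zero_in_positive_ops id_in_strictly_positive_ops by metis
  show ?thesis
    unfolding 1 2 3 4 5 6 7 8 9 10 by (simp add: all_equivalent_def)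
qed

theorem theorem4p7:
  fixes \<sigma> :: "'h::complex_hilbert op_binary"
  assumes nontrivial: "\<exists>v::'h. v \<noteq> 0"
    and conn: "connection \<sigma>"
  shows "(\<forall>f. left_cancellable \<sigma> \<longrightarrow> representing_function \<sigma> f \<longrightarrow>
     all_equivalent
      [nonregular \<sigma>,
       \<exists>x\<ge>0. f x = 0,
       \<exists>!x. x \<ge> 0 \<and> f x = 0,
       \<forall>x\<ge>0. f x = 0 \<longleftrightarrow> x = 0,
       \<forall>A\<in>strictly_positive_ops. \<exists>X\<in>positive_ops. \<sigma> A X = 0,
       \<forall>A\<in>strictly_positive_ops. \<exists>!X. X \<in> positive_ops \<and> \<sigma> A X = 0,
       \<forall>A\<in>strictly_positive_ops. \<forall>X\<in>positive_ops. \<sigma> A X = 0 \<longleftrightarrow> X = 0,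
       \<exists>X\<in>positive_ops. \<sigma> id_blinfun X = 0,
       \<exists>!X. X \<in> positive_ops \<and> \<sigma> id_blinfun X = 0,
       \<forall>X\<in>positive_ops. \<sigma> id_blinfun X = 0 \<longleftrightarrow> X = 0]) \<and>
    (\<forall>g. right_cancellable \<sigma> \<longrightarrow> representing_function (transposed \<sigma>) g \<longrightarrow>
     all_equivalent
      [nonregular (transposed \<sigma>),
       \<exists>x\<ge>0. g x = 0,
       \<exists>!x. x \<ge> 0 \<and> g x = 0,
       \<forall>x\<ge>0. g x = 0 \<longleftrightarrow> x = 0,
       \<forall>A\<in>strictly_positive_ops. \<exists>X\<in>positive_ops. \<sigma> X A = 0,
       \<forall>A\<in>strictly_positive_ops. \<exists>!X. X \<in> positive_ops \<and> \<sigma> X A = 0,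
       \<forall>A\<in>strictly_positive_ops. \<forall>X\<in>positive_ops. \<sigma> X A = 0 \<longleftrightarrow> X = 0,
       \<exists>X\<in>positive_ops. \<sigma> X id_blinfun = 0,
       \<exists>!X. X \<in> positive_ops \<and> \<sigma> X id_blinfun = 0,
       \<forall>X\<in>positive_ops. \<sigma> X id_blinfun = 0 \<longleftrightarrow> X = 0])"
  \<comment> \<open>Right cancellability of \<sigma> is left cancellability of its transpose, which
    is again a connection, so the second half is the first half applied to
    \<open>transposed \<sigma>\<close>.\<close>
  using left_cancellable_zero_equivalences[OF nontrivial conn]
    left_cancellable_zero_equivalences[OF nontrivial connection_transposed[OF conn]]
  by (simp add: transposed_def left_cancellable_def right_cancellable_def)

end
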